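(* Let $X$ and $Y$ be topological spaces, let $(\rho_n)_{n\in\mathbb N}$ be a sequence of binary relations $\rho_n\subseteq X\times Y$, and put $\mathrm{D}:=\bigcap_{n\in\mathbb N}D(\rho_n)$, $\check\rho_n:=\{(x,y)\in\rho_n : x\in \mathrm{D}\}$. Assume that $\mathrm D$ is non-empty and, with the subspace topology from $X$, is a Baire space, that $Y$ is second-countable, and that $\check\rho_n\subseteq \mathrm D\times Y$ is continuous (as a binary relation between $\mathrm D$ and $Y$) for all $n\in\mathbb N$. Let $\mathcal F$ be a Furstenberg family satisfying the following condition: there exist a set $\Delta$ and a countable set $M$ such that $\mathcal F=\bigcup_{\delta\in \Delta}\bigcap_{\nu\in M}\mathcal F_{\delta,\nu}$, where for each $\delta\in \Delta$ and $\nu\in M$ the family $\mathcal F_{\delta,\nu}\subseteq P(\mathbb N)$ has the property that for every $A\in\mathcal F_{\delta,\nu}$ there exists a finite subset $F\subseteq\mathbb N$ such that, for all $B\subseteq \mathbb N$, $A\cap F\subseteq B$ implies $B\in\mathcal F_{\delta,\nu}$. Put $\mathcal F_\delta:=\bigcap_{\nu\in M}\mathcal F_{\delta,\nu}$. Then (i) $\Rightarrow$ (ii) $\Rightarrow$ (iii) $\Rightarrow$ (iv), where: (i) For any non-empty open subset $V$ of $Y$ there is some $\delta\in \Delta$ such that for any non-empty open subset $U$ of $X$ with $U\cap \mathrm D\neq\emptyset$ there is some $x\in U\cap \mathrm D$ such that $\{n\in\mathbb N:\rho_n(x)\cap V\neq\emptyset\}\in\mathcal F_\delta$. (ii) For any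 non-empty open subset $V$ of $Y$ there is some $\delta\in \Delta$ such that, for any non-empty open subset $U$ of $X$ with $U\cap \mathrm D\neq\emptyset$ and for every $\nu\in M$, there is some $x\in U\cap \mathrm D$ such that $\{n\in\mathbb N:\rho_n(x)\cap V\neq\emptyset\}\in\mathcal F_{\delta,\nu}$. (iii) The set of all $\mathcal F$-hypercyclic elements of $(\rho_n)_{n\in\mathbb N}$ is residual in $\mathrm D$. (iv) The sequence $(\rho_n)_{n\in\mathbb N}$ is $\mathcal F$-hypercyclic.
   Context: $\mathbb N=\{1,2,3,\dots\}$. A non-empty collection $\mathcal F$ of subsets of $\mathbb N$ is a Furstenberg family if $A\in\mathcal F$ and $A\subseteq B\subseteq\mathbb N$ imply $B\in\mathcal F$. For a binary relation $\rho\subseteq X\times Y$: $\rho(x):=\{y\in Y:(x,y)\in\rho\}$ (also written $\rho x$), $D(\rho):=\{x\in X:\rho(x)\neq\emptyset\}$, and for $V\subseteq Y$, $\rho^{-1}(V):=\{x\in X:\rho(x)\cap V\neq\emptyset\}$. A relation $\rho\subseteq X\times Y$ between topological spaces is continuous if for every open $V\subseteq Y$ there is an open $U\subseteq X$ with $\rho^{-1}(V)=U\cap D(\rho)$. An element $x\in X$ is an $\mathcal F$-hypercyclic element (vector) of $(\rho_n)_{n\in\mathbb N}$ if $x\in\bigcap_{n\in\mathbb N}D(\rho_n)$ and for each non-empty open $V\subseteq Y$ one has $\{n\in\mathbb N:\rho_n(x)\cap V\neq\emptyset\}\in\mathcal F$. The sequence $(\rho_n)_{n\in\mathbb N}$ is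 $\mathcal F$-hypercyclic if it has an $\mathcal F$-hypercyclic element. A subset of a topological space is residual if it contains a countable intersection of dense open subsets. *)

theory Defs
  imports "HOL-Analysis.Analysis"
begin

text \<open>
  The index set is \<open>{1..}\<close>, the positive integers. For a relation \<open>r\<close>, the image of a
  point \<open>x\<close> is \<open>r `` {x}\<close>, the domain is \<open>Domain r\<close>, and the preimage of \<open>V\<close>, i.e. the set of
  all \<open>x\<close> whose image meets \<open>V\<close>, is \<open>r\<inverse> `` V\<close>.
\<close>

definition furstenberg_family :: "nat set set \<Rightarrow> bool" where
  "furstenberg_family \<F> \<longleftrightarrow>
     \<F> \<noteq> {} \<and> \<F> \<subseteq> Pow {1..} \<and> (\<forall>A B. A \<in> \<F> \<and> A \<subseteq> B \<and> B \<subseteq> {1..} \<longrightarrow> B \<in> \<F>)"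

definition continuous_rel :: "'a topology \<Rightarrow> 'b topology \<Rightarrow> ('a \<times> 'b) set \<Rightarrow> bool" where
  "continuous_rel X Y r \<longleftrightarrow>
     r \<subseteq> topspace X \<times> topspace Y \<and>
     (\<forall>V. openin Y V \<longrightarrow> (\<exists>U. openin X U \<and> r\<inverse> `` V = U \<inter> Domain r))"

definition hit_times :: "(nat \<Rightarrow> ('a \<times> 'b) set) \<Rightarrow> 'a \<Rightarrow> 'b set \<Rightarrow> nat set" where
  "hit_times \<rho> x V = {n \<in> {1..}. \<rho> n `` {x} \<inter> V \<noteq> {}}"

definition hypercyclic_element ::
  "'b topology \<Rightarrow> nat set set \<Rightarrow> (nat \<Rightarrow> ('a \<times> 'b) set) \<Rightarrow> 'a \<Rightarrow> bool" where
  "hypercyclic_element Y \<F> \<rho> x \<longleftrightarrow>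
     x \<in> (\<Inter>n\<in>{1..}. Domain (\<rho> n)) \<and>
     (\<forall>V. openin Y V \<and> V \<noteq> {} \<longrightarrow> hit_times \<rho> x V \<in> \<F>)"

definition hypercyclic_sequence ::
  "'b topology \<Rightarrow> nat set set \<Rightarrow> (nat \<Rightarrow> ('a \<times> 'b) set) \<Rightarrow> bool" where
  "hypercyclic_sequence Y \<F> \<rho> \<longleftrightarrow> (\<exists>x. hypercyclic_element Y \<F> \<rho> x)"

text \<open>
  Intersecting with \<open>topspace X\<close> only matters for the empty family, whose intersection
  is then the whole space.
\<close>

definition Baire_space :: "'a topology \<Rightarrow> bool" where
  "Baire_space X \<longleftrightarrow>
     (\<forall>\<G>. countable \<G> \<and> (\<forall>G\<in>\<G>. openin X G \<and> X closure_of G = topspace X) \<longrightarrow>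
        X closure_of (topspace X \<inter> \<Inter>\<G>) = topspace X)"

definition residual_in :: "'a topology \<Rightarrow> 'a set \<Rightarrow> bool" where
  "residual_in X S \<longleftrightarrow>
     S \<subseteq> topspace X \<and>
     (\<exists>\<G>. countable \<G> \<and> (\<forall>G\<in>\<G>. openin X G \<and> X closure_of G = topspace X) \<and>
        topspace X \<inter> \<Inter>\<G> \<subseteq> S)"

end

theory Submission
  imports Defs
begin

text \<open>
  Membership in \<open>\<H> \<delta> \<nu>\<close> is decided by finitely many hitting times, so by continuity of the
  relations it is an open condition on the point of \<open>D\<close>. Letting \<open>V\<close> range over a countable base
  and \<open>\<nu>\<close> over \<open>M\<close>, (ii) says that each of these countably many open sets is dense, and
  their intersection consists of hypercyclic elements because \<open>\<F>\<close> is upward closed.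
\<close>

lemma openin_preimage_rel:
  assumes "continuous_rel Z Y r" and "openin Y V" and "Domain r = topspace Z"
  shows "openin Z (r\<inverse> `` V)"
  using assms unfolding continuous_rel_def by (metis openin_Int openin_topspace)

text \<open>Near a point \<open>x\<close> of this set, only the hits of \<open>x\<close> at times in
  the finite set \<open>F\<close> have to persist, and each persists on an open set by continuity.
  Times in \<open>F\<close> at which \<open>x\<close> misses \<open>V\<close> impose no condition,
  since \<open>fin\<close> asks for an inclusion from below only.\<close>

lemma openin_hit_times_in:
  assumes dom: "topspace Z \<subseteq> (\<Inter>n\<in>{1..}. Domain (\<rho> n))"
    and cont: "\<And>n. n \<ge> 1 \<Longrightarrow> continuous_rel Z Y {(x, y) \<in> \<rho> n. x \<in> topspace Z}"
    and V: "openin Y V"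
    and fin: "\<And>A. A \<in> \<A> \<Longrightarrow>
      \<exists>F. finite F \<and> F \<subseteq> {1..} \<and> (\<forall>B. B \<subseteq> {1..} \<longrightarrow> A \<inter> F \<subseteq> B \<longrightarrow> B \<in> \<A>)"
  shows "openin Z {x \<in> topspace Z. hit_times \<rho> x V \<in> \<A>}"
proof (subst openin_subopen, intro ballI)
  fix x assume x: "x \<in> {x \<in> topspace Z. hit_times \<rho> x V \<in> \<A>}"
  then obtain F where F: "finite F" "F \<subseteq> {1..}"
    "\<And>B. B \<subseteq> {1..} \<Longrightarrow> hit_times \<rho> x V \<inter> F \<subseteq> B \<Longrightarrow> B \<in> \<A>"
    using fin[of "hit_times \<rho> x V"] by auto
  define N where "N = hit_times \<rho> x V \<inter> F"
  define P where "P n = {z \<in> topspace Z. \<rho> n `` {z} \<inter> V \<noteq> {}}" for n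
  \<comment> \<open>For empty \<open>N\<close> the intersection over \<open>N\<close> is
    \<open>UNIV\<close>; the factor \<open>topspace Z\<close> then makes \<open>T\<close> the whole
    space.\<close>
  define T where "T = topspace Z \<inter> (\<Inter>n\<in>N. P n)"
  have P_open: "openin Z (P n)" if "n \<ge> 1" for n
  proof -
    have "topspace Z \<subseteq> Domain (\<rho> n)"
      using dom that by auto
    \<comment> \<open>Totality on \<open>topspace Z\<close> turns the relatively open preimage given
      by continuity into an open one.\<close>
    then have "Domain {(x, y) \<in> \<rho> n. x \<in> topspace Z} = topspace Z"
      by blast
    with cont[OF that] V have "openin Z ({(x, y) \<in> \<rho> n. x \<in> topspace Z}\<inverse> `` V)"
      by (rule openin_preimage_rel)
    also have "{(x, y) \<in> \<rho> n. x \<in> topspace Z}\<inverse> `` V = P n"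
      by (auto simp: P_def)
    finally show ?thesis .
  qed
  have "finite N" "N \<subseteq> {1..}"
    using F by (auto simp: N_def)
  then have "openin Z T"
    using P_open by (cases "N = {}") (auto simp: T_def intro!: openin_Int openin_INT2)
  moreover have "x \<in> T"
    using x by (auto simp: T_def P_def N_def hit_times_def)
  moreover have "hit_times \<rho> z V \<in> \<A>" if "z \<in> T" for z
    using that F(2) by (intro F(3)) (auto simp: T_def P_def N_def hit_times_def)
  ultimately show "\<exists>T. openin Z T \<and> x \<in> T \<and> T \<subseteq> {x \<in> topspace Z. hit_times \<rho> x V \<in> \<A>}"
    by (intro exI[of _ T]) (auto simp: T_def)
qed

text \<open>The Baire property makes the countable intersection inside \<open>S\<close> dense, and
  the empty set is not dense in a non-empty space.\<close>

lemma residual_in_Baire_nonempty: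
  assumes "Baire_space Z" and "residual_in Z S" and "topspace Z \<noteq> {}"
  shows "S \<noteq> {}"
proof -
  from assms(2) obtain \<G> where \<G>: "countable \<G>" "\<forall>G\<in>\<G>. openin Z G \<and> Z closure_of G = topspace Z"
    "topspace Z \<inter> \<Inter>\<G> \<subseteq> S"
    unfolding residual_in_def by blast
  then have "Z closure_of (topspace Z \<inter> \<Inter>\<G>) = topspace Z"
    using assms(1) unfolding Baire_space_def by blast
  with assms(3) \<G>(3) show ?thesis
    by (metis closure_of_empty subset_empty)
qed

lemma hit_times_mono: "V \<subseteq> W \<Longrightarrow> hit_times \<rho> x V \<subseteq> hit_times \<rho> x W"
  by (auto simp: hit_times_def)

text \<open>Open sets of the subspace are traces \<open>U \<inter> D\<close>, and
  \<open>G \<subseteq> D\<close> absorbs the factor \<open>D\<close>. This puts density in the form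
  used in (ii), with \<open>U\<close> open in \<open>X\<close>.\<close>

lemma dense_in_subtopology_iff:
  assumes "D \<subseteq> topspace X" and "G \<subseteq> D"
  shows "subtopology X D closure_of G = D \<longleftrightarrow>
    (\<forall>U. openin X U \<and> U \<inter> D \<noteq> {} \<longrightarrow> U \<inter> G \<noteq> {})"
proof -
  have "topspace (subtopology X D) = D"
    using assms(1) by (simp add: Int_absorb1)
  then have "subtopology X D closure_of G = D \<longleftrightarrow>
      (\<forall>T. openin (subtopology X D) T \<and> T \<noteq> {} \<longrightarrow> G \<inter> T \<noteq> {})"
    using dense_intersects_open[of "subtopology X D" G] by simp
  also have "\<dots> \<longleftrightarrow> (\<forall>U. openin X U \<and> U \<inter> D \<noteq> {} \<longrightarrow> G \<inter> (U \<inter> D) \<noteq> {})"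
    unfolding openin_subtopology by metis
  also have "\<dots> \<longleftrightarrow> (\<forall>U. openin X U \<and> U \<inter> D \<noteq> {} \<longrightarrow> U \<inter> G \<noteq> {})"
    using assms(2) by (simp add: Int_commute Int_left_commute Int_absorb1)
  finally show ?thesis .
qed

theorem theorem3p2:
  fixes X :: "'a topology" and Y :: "'b topology"
    and \<rho> :: "nat \<Rightarrow> ('a \<times> 'b) set" and D :: "'a set"
    and \<F> :: "nat set set"
    and \<Delta> :: "'d set" and M :: "'m set"
    and \<H> :: "'d \<Rightarrow> 'm \<Rightarrow> nat set set" and \<K> :: "'d \<Rightarrow> nat set set"
  assumes rel: "\<And>n. n \<ge> 1 \<Longrightarrow> \<rho> n \<subseteq> topspace X \<times> topspace Y"
    and D_eq: "D = (\<Inter>n\<in>{1..}. Domain (\<rho> n))"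
    and D_nonempty: "D \<noteq> {}"
    and D_Baire: "Baire_space (subtopology X D)"
    and Y_second_countable: "second_countable Y"
    and cont: "\<And>n. n \<ge> 1 \<Longrightarrow> continuous_rel (subtopology X D) Y {(x, y) \<in> \<rho> n. x \<in> D}"
    and furst: "furstenberg_family \<F>"
    and M_countable: "countable M"
    and \<H>_subset: "\<And>\<delta> \<nu>. \<delta> \<in> \<Delta> \<Longrightarrow> \<nu> \<in> M \<Longrightarrow> \<H> \<delta> \<nu> \<subseteq> Pow {1..}"
    and \<H>_finite: "\<And>\<delta> \<nu> A. \<delta> \<in> \<Delta> \<Longrightarrow> \<nu> \<in> M \<Longrightarrow> A \<in> \<H> \<delta> \<nu> \<Longrightarrow>
        \<exists>F. finite F \<and> F \<subseteq> {1..} \<and> (\<forall>B. B \<subseteq> {1..} \<longrightarrow> A \<inter> F \<subseteq> B \<longrightarrow> B \<in> \<H> \<delta> \<nu>)"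
    and \<K>_eq: "\<And>\<delta>. \<delta> \<in> \<Delta> \<Longrightarrow> \<K> \<delta> = Pow {1..} \<inter> (\<Inter>\<nu>\<in>M. \<H> \<delta> \<nu>)"
    and \<F>_eq: "\<F> = (\<Union>\<delta>\<in>\<Delta>. \<K> \<delta>)"
  shows
    "((\<forall>V. openin Y V \<and> V \<noteq> {} \<longrightarrow>
        (\<exists>\<delta>\<in>\<Delta>. \<forall>U. openin X U \<and> U \<noteq> {} \<and> U \<inter> D \<noteq> {} \<longrightarrow>
          (\<exists>x\<in>U \<inter> D. hit_times \<rho> x V \<in> \<K> \<delta>)))
      \<longrightarrow>
      (\<forall>V. openin Y V \<and> V \<noteq> {} \<longrightarrow>
        (\<exists>\<delta>\<in>\<Delta>. \<forall>U. openin X U \<and> U \<noteq> {} \<and> U \<inter> D \<noteq> {} \<longrightarrow>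
          (\<forall>\<nu>\<in>M. \<exists>x\<in>U \<inter> D. hit_times \<rho> x V \<in> \<H> \<delta> \<nu>))))
     \<and>
     ((\<forall>V. openin Y V \<and> V \<noteq> {} \<longrightarrow>
        (\<exists>\<delta>\<in>\<Delta>. \<forall>U. openin X U \<and> U \<noteq> {} \<and> U \<inter> D \<noteq> {} \<longrightarrow>
          (\<forall>\<nu>\<in>M. \<exists>x\<in>U \<inter> D. hit_times \<rho> x V \<in> \<H> \<delta> \<nu>)))
      \<longrightarrow>
      residual_in (subtopology X D) {x. hypercyclic_element Y \<F> \<rho> x})
     \<and>
     (residual_in (subtopology X D) {x. hypercyclic_element Y \<F> \<rho> x}
      \<longrightarrow>
      hypercyclic_sequence Y \<F> \<rho>)"
proof -
  define Z where "Z = subtopology X D"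
  have D_sub: "D \<subseteq> topspace X"
    using rel[of 1] by (auto simp: D_eq)
  then have Z_top: "topspace Z = D"
    by (simp add: Z_def Int_absorb1)
  let ?ii = "\<forall>V. openin Y V \<and> V \<noteq> {} \<longrightarrow>
        (\<exists>\<delta>\<in>\<Delta>. \<forall>U. openin X U \<and> U \<noteq> {} \<and> U \<inter> D \<noteq> {} \<longrightarrow>
          (\<forall>\<nu>\<in>M. \<exists>x\<in>U \<inter> D. hit_times \<rho> x V \<in> \<H> \<delta> \<nu>))"
  have i_ii: ?ii
    if i: "\<forall>V. openin Y V \<and> V \<noteq> {} \<longrightarrow>
        (\<exists>\<delta>\<in>\<Delta>. \<forall>U. openin X U \<and> U \<noteq> {} \<and> U \<inter> D \<noteq> {} \<longrightarrow>
          (\<exists>x\<in>U \<inter> D. hit_times \<rho> x V \<in> \<K> \<delta>))"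
  proof (intro allI impI)
    fix V assume "openin Y V \<and> V \<noteq> {}"
    with i obtain \<delta> where \<delta>: "\<delta> \<in> \<Delta>"
      and hit: "\<And>U. openin X U \<and> U \<noteq> {} \<and> U \<inter> D \<noteq> {} \<Longrightarrow> \<exists>x\<in>U \<inter> D. hit_times \<rho> x V \<in> \<K> \<delta>"
      by blast
    \<comment> \<open>By this inclusion, the \<open>\<delta>\<close> and the points \<open>x\<close>
      from (i) serve for every \<open>\<nu>\<close> at once.\<close>
    have "\<forall>\<nu>\<in>M. \<K> \<delta> \<subseteq> \<H> \<delta> \<nu>"
      using \<K>_eq[OF \<delta>] by blast
    with \<delta> hit show "\<exists>\<delta>\<in>\<Delta>. \<forall>U. openin X U \<and> U \<noteq> {} \<and> U \<inter> D \<noteq> {} \<longrightarrow>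
        (\<forall>\<nu>\<in>M. \<exists>x\<in>U \<inter> D. hit_times \<rho> x V \<in> \<H> \<delta> \<nu>)"
      by (meson subsetD)
  qed
  have ii_iii: "residual_in Z {x. hypercyclic_element Y \<F> \<rho> x}" if ii: ?ii
  proof -
    obtain \<B> where \<B>: "countable \<B>" "\<And>V. V \<in> \<B> \<Longrightarrow> openin Y V"
      and base: "\<And>V y. openin Y V \<Longrightarrow> y \<in> V \<Longrightarrow> \<exists>W\<in>\<B>. y \<in> W \<and> W \<subseteq> V"
      using Y_second_countable unfolding second_countable_def by meson
    \<comment> \<open>The choice of \<open>\<delta> V\<close> depends neither on \<open>U\<close>
      nor on \<open>\<nu>\<close>. Hence a point lying in the sets for all \<open>\<nu>\<close> at
      once has its hitting times in a single \<open>\<K> (\<delta> V)\<close>.\<close>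
    obtain \<delta> where \<delta>: "\<And>V. openin Y V \<Longrightarrow> V \<noteq> {} \<Longrightarrow> \<delta> V \<in> \<Delta>"
      and hit: "\<And>V U \<nu>. openin Y V \<Longrightarrow> V \<noteq> {} \<Longrightarrow> openin X U \<Longrightarrow> U \<inter> D \<noteq> {} \<Longrightarrow> \<nu> \<in> M \<Longrightarrow>
        \<exists>x\<in>U \<inter> D. hit_times \<rho> x V \<in> \<H> (\<delta> V) \<nu>"
      using ii by (metis inf_bot_left)
    define G where "G V \<nu> = {x \<in> D. hit_times \<rho> x V \<in> \<H> (\<delta> V) \<nu>}" for V \<nu>
    \<comment> \<open>The empty set is removed from the base because (ii) says nothing about empty
      \<open>V\<close>.\<close>
    define \<G> where "\<G> = (\<lambda>(V, \<nu>). G V \<nu>) ` ((\<B> - {{}}) \<times> M)"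
    have "countable \<G>"
      unfolding \<G>_def using \<B>(1) M_countable by (intro countable_image countable_SIGMA) auto
    moreover have "openin Z (G V \<nu>) \<and> Z closure_of G V \<nu> = topspace Z"
      if V: "V \<in> \<B>" "V \<noteq> {}" and \<nu>: "\<nu> \<in> M" for V \<nu>
    proof
      show "openin Z (G V \<nu>)"
        unfolding G_def Z_top[symmetric]
        by (rule openin_hit_times_in[where Y = Y])
          (use D_eq Z_top cont \<B>(2) V \<nu> \<delta> \<H>_finite in \<open>auto simp: Z_def\<close>)
      \<comment> \<open>The point of \<open>U \<inter> D\<close> provided by (ii) is itself a member
        of \<open>G V \<nu>\<close>.\<close>
      have "\<forall>U. openin X U \<and> U \<inter> D \<noteq> {} \<longrightarrow> U \<inter> G V \<nu> \<noteq> {}"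
        using hit[OF \<B>(2)[OF V(1)] V(2) _ _ \<nu>] by (fastforce simp: G_def)
      then show "Z closure_of G V \<nu> = topspace Z"
        unfolding Z_top unfolding Z_def
        by (subst dense_in_subtopology_iff[OF D_sub]) (auto simp: G_def)
    qed
    then have "\<forall>S\<in>\<G>. openin Z S \<and> Z closure_of S = topspace Z"
      by (auto simp: \<G>_def)
    moreover have "hypercyclic_element Y \<F> \<rho> x" if x: "x \<in> D" "x \<in> \<Inter>\<G>" for x
      unfolding hypercyclic_element_def
    proof (intro conjI allI impI)
      fix V assume V: "openin Y V \<and> V \<noteq> {}"
      \<comment> \<open>An arbitrary \<open>V\<close> is replaced by a basic set inside it: every
        hit of \<open>W\<close> is a hit of \<open>V\<close>, so upward closure of
        \<open>\<F>\<close> carries membership from \<open>W\<close> to \<open>V\<close>.\<close>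
      then obtain W where W: "W \<in> \<B>" "W \<noteq> {}" "W \<subseteq> V"
        using base by blast
      have "hit_times \<rho> x W \<in> \<H> (\<delta> W) \<nu>" if "\<nu> \<in> M" for \<nu>
        using x W that by (auto simp: \<G>_def G_def)
      \<comment> \<open>Membership in \<open>Pow {1..}\<close> comes from the definition of
        \<open>hit_times\<close>, which also covers the case of empty \<open>M\<close>.\<close>
      then have "hit_times \<rho> x W \<in> \<K> (\<delta> W)"
        using \<K>_eq[OF \<delta>[OF \<B>(2)[OF W(1)] W(2)]] by (auto simp: hit_times_def)
      then have "hit_times \<rho> x W \<in> \<F>"
        using \<delta>[OF \<B>(2)[OF W(1)] W(2)] \<F>_eq by blast
      moreover have "hit_times \<rho> x V \<subseteq> {1..}"
        by (auto simp: hit_times_def)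
      ultimately show "hit_times \<rho> x V \<in> \<F>"
        using furst hit_times_mono[OF W(3)] unfolding furstenberg_family_def by metis
    qed (use x D_eq in simp)
    moreover have "{x. hypercyclic_element Y \<F> \<rho> x} \<subseteq> D"
      by (auto simp: hypercyclic_element_def D_eq)
    ultimately show ?thesis
      unfolding residual_in_def Z_top by (intro conjI exI[of _ \<G>] subsetI CollectI) auto
  qed
  have iii_iv: "hypercyclic_sequence Y \<F> \<rho>"
    if "residual_in Z {x. hypercyclic_element Y \<F> \<rho> x}"
    using residual_in_Baire_nonempty[OF _ that] D_Baire D_nonempty Z_top
    unfolding hypercyclic_sequence_def Z_def by auto
  show ?thesis
    by (intro conjI impI)
      (rule i_ii ii_iii[unfolded Z_def] iii_iv[unfolded Z_def], assumption)+
qed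

end
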